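(* For every slope on the boundary torus of the manifold $v2503$, the fundamental group of the closed $3$-manifold obtained by Dehn filling $v2503$ along that slope is not left orderable.
   Context: $v2503$ is the one-cusped hyperbolic $3$-manifold of that name in the SnapPy census (a hyperbolic $\mathbf{Q}$-homology solid torus), regarded as a compact manifold with one torus boundary component. Its fundamental group has the presentation $$\pi_1(v2503)=\langle a,b\mid a^2b^{-2}ab^{-2}a^2ba^2baba^2b=1\rangle,$$ and a meridian $\mu$ and a longitude $\lambda$ (a basis of the peripheral subgroup) can be written as $$\mu=b^{-2}ab^{-2}ab^{-1},\qquad \lambda=a^{-2}b^{-1}a^{-2}b.$$ Dehn filling with slope $\frac pq$ (with $p,q$ coprime integers, $\frac10$ allowed) has fundamental group the quotient of $\pi_1(v2503)$ by the normal closure of $\mu^p\lambda^q$. A nontrivial group $G$ is left orderable if it admits a total order $\le$ such that $g\le h$ implies $fg\le fh$ for all $f,g,h\in G$; the trivial group is by convention not left orderable. *)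

theory Defs
  imports "HOL-Algebra.Algebra"
begin

section \<open>Free groups\<close>

text \<open>
  The letter \<open>(x, True)\<close> stands for the generator \<open>x\<close> and \<open>(x, False)\<close> for its inverse.
  The free group on the elements of a type has the reduced words as its elements.
\<close>

type_synonym 'a letter = "'a \<times> bool"

definition inv_letter :: "'a letter \<Rightarrow> 'a letter" where
  "inv_letter l = (fst l, \<not> snd l)"

definition reduced :: "'a letter list \<Rightarrow> bool" where
  "reduced w \<longleftrightarrow> successively (\<lambda>k l. l \<noteq> inv_letter k) w"

fun red_cons :: "'a letter \<Rightarrow> 'a letter list \<Rightarrow> 'a letter list" where
  "red_cons k [] = [k]"
| "red_cons k (l # w) = (if l = inv_letter k then w else k # l # w)"

definition free_group :: "'a letter list monoid" where
  "free_group = \<lparr>carrier = {w. reduced w}, monoid.mult = (\<lambda>u v. foldr red_cons u v), one = []\<rparr>"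

definition free_gen :: "'a \<Rightarrow> 'a letter list" where
  "free_gen x = [(x, True)]"

lemma inv_letter_inv_letter [simp]: "inv_letter (inv_letter k) = k"
  by (simp add: inv_letter_def)

lemma inv_letter_neq [simp]: "inv_letter k \<noteq> k" "k \<noteq> inv_letter k"
  by (auto simp: inv_letter_def prod_eq_iff)

lemma reduced_ConsD: "reduced (k # w) \<Longrightarrow> reduced w"
  by (cases w) (auto simp: reduced_def)

lemma reduced_red_cons: "reduced w \<Longrightarrow> reduced (red_cons k w)"
  by (cases w) (auto simp: reduced_def successively_Cons)

lemma reduced_foldr_red_cons: "reduced v \<Longrightarrow> reduced (foldr red_cons u v)"
  by (induction u) (auto intro: reduced_red_cons)

lemma foldr_red_cons_Nil: "reduced u \<Longrightarrow> foldr red_cons u [] = u"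
proof (induction u)
  case (Cons k u)
  then show ?case
    by (cases u) (auto simp: reduced_def)
qed simp

lemma red_cons_cancel: "reduced w \<Longrightarrow> red_cons k (red_cons (inv_letter k) w) = w"
proof (cases w)
  case (Cons l w')
  moreover assume "reduced w"
  ultimately show ?thesis
    by (cases w') (auto simp: reduced_def)
qed simp

lemma foldr_red_cons_red_cons:
  assumes "reduced v"
  shows "foldr red_cons (red_cons k u) v = red_cons k (foldr red_cons u v)"
proof (cases u)
  case (Cons l u')
  then show ?thesis
    using red_cons_cancel[OF reduced_foldr_red_cons[OF assms, of u'], of k] by auto
qed simp

lemma foldr_red_cons_assoc:
  "reduced w \<Longrightarrow> foldr red_cons (foldr red_cons u v) w = foldr red_cons u (foldr red_cons v w)"
  by (induction u) (auto simp: foldr_red_cons_red_cons)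

lemma free_group_left_inverse:
  "reduced u \<Longrightarrow> \<exists>v. reduced v \<and> foldr red_cons v u = []"
proof (induction u)
  case Nil
  then show ?case by (intro exI[of _ "[]"]) simp
next
  case (Cons k u)
  then obtain v where v: "reduced v" "foldr red_cons v u = []"
    using reduced_ConsD by blast
  let ?v = "foldr red_cons v [inv_letter k]"
  have "reduced [inv_letter k]"
    by (simp add: reduced_def)
  then have "reduced ?v"
    by (rule reduced_foldr_red_cons)
  moreover have "foldr red_cons ?v (k # u) = []"
    using v Cons.prems by (simp add: foldr_red_cons_assoc)
  ultimately show ?case by blast
qed

lemma group_free_group: "group free_group"
  by (rule groupI)
     (auto simp: free_group_def reduced_foldr_red_cons foldr_red_cons_assoc
        free_group_left_inverse, simp add: reduced_def)

lemma free_gen_carrier: "free_gen x \<in> carrier free_group"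
  by (simp add: free_gen_def free_group_def reduced_def)


section \<open>Normal closures\<close>

definition normal_closure :: "('a, 'm) monoid_scheme \<Rightarrow> 'a set \<Rightarrow> 'a set" where
  "normal_closure G S = generate G {g \<otimes> s \<otimes> inv g | g s. g \<in> carrier G \<and> s \<in> S}"
  for G (structure)

lemma (in group) normal_closure_normal:
  assumes "S \<subseteq> carrier G"
  shows "normal_closure G S \<lhd> G"
  unfolding normal_closure_def
proof (rule normal_generateI)
  show "{g \<otimes> s \<otimes> inv g | g s. g \<in> carrier G \<and> s \<in> S} \<subseteq> carrier G"
    using assms by auto
next
  fix h g
  assume "h \<in> {g \<otimes> s \<otimes> inv g | g s. g \<in> carrier G \<and> s \<in> S}" and g: "g \<in> carrier G"
  then obtain k s where h: "h = k \<otimes> s \<otimes> inv k" and k: "k \<in> carrier G" and s: "s \<in> S"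
    by blast
  have "s \<in> carrier G" using s assms by blast
  then have "g \<otimes> h \<otimes> inv g = (g \<otimes> k) \<otimes> s \<otimes> inv (g \<otimes> k)"
    using g k by (simp add: h m_assoc inv_mult_group)
  then show "g \<otimes> h \<otimes> inv g \<in> {g \<otimes> s \<otimes> inv g | g s. g \<in> carrier G \<and> s \<in> S}"
    using g k s m_closed by blast
qed


section \<open>Left orderability\<close>

text \<open>The trivial group is not left orderable, by convention.\<close>

definition left_orderable :: "('a, 'm) monoid_scheme \<Rightarrow> bool" where
  "left_orderable G \<longleftrightarrow> carrier G \<noteq> {\<one>} \<and>
     (\<exists>r. linear_order_on (carrier G) r \<and>
       (\<forall>f\<in>carrier G. \<forall>g\<in>carrier G. \<forall>h\<in>carrier G. (g, h) \<in> r \<longrightarrow> (f \<otimes> g, f \<otimes> h) \<in> r))"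
  for G (structure)


section \<open>The fundamental groups of \<open>v2503\<close> and of its Dehn fillings\<close>

datatype v2503_gen = Gen_a | Gen_b

definition v2503_relator :: "('a, 'm) monoid_scheme \<Rightarrow> 'a \<Rightarrow> 'a \<Rightarrow> 'a" where
  "v2503_relator G a b =
     a [^] (2::int) \<otimes> b [^] (-2::int) \<otimes> a \<otimes> b [^] (-2::int) \<otimes> a [^] (2::int) \<otimes> b \<otimes>
     a [^] (2::int) \<otimes> b \<otimes> a \<otimes> b \<otimes> a [^] (2::int) \<otimes> b"
  for G (structure)

definition v2503_relators :: "v2503_gen letter list set" where
  "v2503_relators = {v2503_relator free_group (free_gen Gen_a) (free_gen Gen_b)}"

definition v2503_group :: "v2503_gen letter list set monoid" where
  "v2503_group = free_group Mod normal_closure free_group v2503_relators"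

definition v2503_elem :: "v2503_gen \<Rightarrow> v2503_gen letter list set" where
  "v2503_elem x = normal_closure free_group v2503_relators #>\<^bsub>free_group\<^esub> free_gen x"

definition meridian_word :: "('a, 'm) monoid_scheme \<Rightarrow> 'a \<Rightarrow> 'a \<Rightarrow> 'a" where
  "meridian_word G a b =
     b [^] (-2::int) \<otimes> a \<otimes> b [^] (-2::int) \<otimes> a \<otimes> b [^] (-1::int)"
  for G (structure)

definition longitude_word :: "('a, 'm) monoid_scheme \<Rightarrow> 'a \<Rightarrow> 'a \<Rightarrow> 'a" where
  "longitude_word G a b =
     a [^] (-2::int) \<otimes> b [^] (-1::int) \<otimes> a [^] (-2::int) \<otimes> b"
  for G (structure)

definition v2503_meridian :: "v2503_gen letter list set" where
  "v2503_meridian = meridian_word v2503_group (v2503_elem Gen_a) (v2503_elem Gen_b)"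

definition v2503_longitude :: "v2503_gen letter list set" where
  "v2503_longitude = longitude_word v2503_group (v2503_elem Gen_a) (v2503_elem Gen_b)"

text \<open>
  The fundamental group of the Dehn filling of \<open>v2503\<close> with slope \<open>p/q\<close>, where \<open>p\<close> and \<open>q\<close>
  are coprime. The slope \<open>1/0\<close> is \<open>p = 1\<close>, \<open>q = 0\<close>; the pairs \<open>(p, q)\<close> and \<open>(- p, - q)\<close>
  describe the same slope.
\<close>

definition v2503_filling_group :: "int \<Rightarrow> int \<Rightarrow> v2503_gen letter list set set monoid" where
  "v2503_filling_group p q =
     v2503_group Mod normal_closure v2503_group
       {v2503_meridian [^]\<^bsub>v2503_group\<^esub> p \<otimes>\<^bsub>v2503_group\<^esub> v2503_longitude [^]\<^bsub>v2503_group\<^esub> q}"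

lemma v2503_relators_carrier: "v2503_relators \<subseteq> carrier free_group"
proof -
  interpret group "free_group :: v2503_gen letter list monoid" by (rule group_free_group)
  show ?thesis
    unfolding v2503_relators_def v2503_relator_def
    by (simp add: free_gen_carrier)
qed

lemma normal_v2503_relators: "normal_closure free_group v2503_relators \<lhd> free_group"
  by (rule group.normal_closure_normal[OF group_free_group v2503_relators_carrier])

lemma group_v2503_group: "group v2503_group"
  unfolding v2503_group_def by (rule normal.factorgroup_is_group[OF normal_v2503_relators])

lemma v2503_elem_carrier: "v2503_elem x \<in> carrier v2503_group"
  unfolding v2503_elem_def v2503_group_def FactGroup_def RCOSETS_def
  by (auto intro: free_gen_carrier)

lemma v2503_peripheral_carrier:
  "v2503_meridian \<in> carrier v2503_group" "v2503_longitude \<in> carrier v2503_group"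
proof -
  interpret group v2503_group by (rule group_v2503_group)
  show "v2503_meridian \<in> carrier v2503_group" "v2503_longitude \<in> carrier v2503_group"
    unfolding v2503_meridian_def meridian_word_def v2503_longitude_def longitude_word_def
    by (simp_all add: v2503_elem_carrier)
qed

lemma group_v2503_filling_group: "group (v2503_filling_group p q)"
proof -
  interpret group v2503_group by (rule group_v2503_group)
  show ?thesis
    unfolding v2503_filling_group_def
    by (intro normal.factorgroup_is_group normal_closure_normal)
       (simp add: v2503_peripheral_carrier)
qed

end

theory Submission
  imports Defs
begin

text \<open>
  In the filling group the images of \<open>\<mu>\<close> and \<open>\<lambda>\<close> are powers of one element \<open>c\<close>. Suppose that the
  group is left-ordered.

  If \<open>c\<close> is not cofinal, it fixes a proper cut of the order, so that there is a nontrivial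
  left-invariant total preorder in which \<open>\<mu>\<close> is equivalent to \<open>1\<close>. Reversing it if necessary,
  let \<open>a \<ge> 1\<close>. If \<open>b \<le> 1\<close>, then \<open>b = \<mu>\<inverse> b\<^sup>-\<^sup>2 a b\<^sup>-\<^sup>2 a \<ge> 1\<close>, so \<open>b \<ge> 1\<close> anyway. The relator equals
  \<open>a\<^sup>2 \<mu> b a b a\<^sup>2 b a b a\<^sup>2 b\<close>, a positive word, so all its factors are equivalent to \<open>1\<close>
  and the preorder is trivial.

  If \<open>c\<close> is cofinal, all conjugates of \<open>\<lambda>\<close> are \<open>\<ge> 1\<close> or all are \<open>\<le> 1\<close>. The relator makes \<open>a\<^sup>2\<close>
  a product of two conjugates of \<open>\<lambda>\<close>, while \<open>\<lambda>\<close> is a product of two conjugates of \<open>a\<^sup>-\<^sup>2\<close>.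
  Hence \<open>a\<^sup>2 = 1\<close> and \<open>a = 1\<close>, although \<open>a\<close> survives in the quotient \<open>a \<mapsto> 1, b \<mapsto> 0\<close> to
  \<open>\<int>/2\<close>.
\<close>

section \<open>Words in groups\<close>

context group
begin

lemma inv_mult_cancel:
  assumes "x \<in> carrier G" "y \<in> carrier G"
  shows "inv x \<otimes> (x \<otimes> y) = y" "x \<otimes> (inv x \<otimes> y) = y"
  using assms by (simp_all flip: m_assoc)

lemma int_pow_small:
  assumes "x \<in> carrier G"
  shows "x [^] (2::int) = x \<otimes> x" "x [^] (-2::int) = inv x \<otimes> inv x" "x [^] (-1::int) = inv x"
proof -
  show *: "x [^] (2::int) = x \<otimes> x"
    using assms int_pow_mult[OF assms, of 1 1] by simp
  show "x [^] (-2::int) = inv x \<otimes> inv x" "x [^] (-1::int) = inv x"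
    using assms * by (simp_all add: int_pow_neg inv_mult_group)
qed

lemmas word_simps = int_pow_small m_assoc inv_mult_group inv_mult_cancel

lemma word_closed [simp]:
  assumes "a \<in> carrier G" "b \<in> carrier G"
  shows "v2503_relator G a b \<in> carrier G" "meridian_word G a b \<in> carrier G"
    "longitude_word G a b \<in> carrier G"
  using assms by (simp_all add: v2503_relator_def meridian_word_def longitude_word_def)

text \<open>A free identity in which the meridian absorbs all negative letters. The outer
  \<open>a\<close> and \<open>b\<close> stay separate so that the relation can be solved for
  \<open>inv a\<close> and for \<open>inv b\<close> as positive words.\<close>

lemma v2503_relator_eq_meridian:
  assumes "a \<in> carrier G" "b \<in> carrier G"
  shows "v2503_relator G a b =
    a \<otimes> (a \<otimes> meridian_word G a b \<otimes> b \<otimes> a \<otimes> b \<otimes> a \<otimes> a \<otimes> b \<otimes> a \<otimes> b \<otimes> a \<otimes> a) \<otimes> b"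
  using assms by (simp add: v2503_relator_def meridian_word_def word_simps)

text \<open>Also a free identity. Once the relator is 1, it transfers the sign of the longitude to
  a^2.\<close>

lemma v2503_relator_eq_longitude:
  assumes "a \<in> carrier G" "b \<in> carrier G"
  defines "g \<equiv> a \<otimes> a \<otimes> inv b \<otimes> inv b \<otimes> a \<otimes> inv b" and "h \<equiv> a \<otimes> a \<otimes> inv b"
  shows "v2503_relator G a b =
    inv ((h \<otimes> longitude_word G a b \<otimes> inv h) \<otimes> (g \<otimes> longitude_word G a b \<otimes> inv g)) \<otimes> (a \<otimes> a)"
  using assms by (simp add: v2503_relator_def longitude_word_def word_simps)

text \<open>
  With \<open>v = b\<inverse> a b\<inverse>\<close> and \<open>m = \<mu>\<inverse>\<close> one has \<open>b = v\<^sup>2 m\<close> and \<open>a = b v b\<close>. For the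
  palindromes \<open>Y\<close> and \<open>Z\<close> below, \<open>\<lambda>\<inverse> = Z m Y v m = v Y m Z m\<close> holds freely, and the relator
  says \<open>Y = \<lambda> v \<lambda>\<close>. Eliminating \<open>Y\<close> and \<open>Z\<close> gives \<open>m \<lambda>\<inverse> m\<inverse> = \<lambda>\<inverse>\<close>.
\<close>

lemma meridian_longitude_commute:
  assumes a: "a \<in> carrier G" and b: "b \<in> carrier G" and rel: "v2503_relator G a b = \<one>"
  shows "meridian_word G a b \<otimes> longitude_word G a b = longitude_word G a b \<otimes> meridian_word G a b"
proof -
  define l where "l = longitude_word G a b"
  define m where "m = inv (meridian_word G a b)"
  define v where "v = inv b \<otimes> a \<otimes> inv b"
  define Y where "Y = v \<otimes> v \<otimes> m \<otimes> v \<otimes> v \<otimes> m \<otimes> v \<otimes> v \<otimes> v \<otimes> m \<otimes> v \<otimes> v \<otimes> m \<otimes> v \<otimes> v"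
  define Z where "Z = v \<otimes> v \<otimes> v \<otimes> m \<otimes> v \<otimes> v \<otimes> m \<otimes> v \<otimes> v \<otimes> v"
  \<comment> \<open>Freely, Y^-1 l v l is the conjugate by \<open>g\<close> of the inverse relator;
    the relation enters the proof only here.\<close>
  define g where "g = inv b \<otimes> a \<otimes> a \<otimes> b \<otimes> a \<otimes> a \<otimes> b \<otimes> a \<otimes> b \<otimes> a \<otimes> a \<otimes> b"
  have [simp]: "l \<in> carrier G" "m \<in> carrier G" "v \<in> carrier G"
    using a b by (simp_all add: l_def m_def v_def)
  then have [simp]: "Y \<in> carrier G" "Z \<in> carrier G"
    by (simp_all add: Y_def Z_def)
  have "inv Y \<otimes> (l \<otimes> v \<otimes> l) = g \<otimes> inv (v2503_relator G a b) \<otimes> inv g"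
    using a b unfolding Y_def
    by (simp add: l_def v_def m_def g_def v2503_relator_def meridian_word_def
        longitude_word_def word_simps)
  also have "\<dots> = \<one>"
    using a b by (simp add: rel g_def)
  finally have Y: "l \<otimes> v \<otimes> l = Y"
    by (metis inv_comm inv_equality inv_inv inv_closed \<open>Y \<in> carrier G\<close> \<open>l \<in> carrier G\<close>
        \<open>v \<in> carrier G\<close> m_closed)
  have l1: "inv l = Z \<otimes> m \<otimes> Y \<otimes> v \<otimes> m"
    using a b unfolding Y_def Z_def
    by (simp add: l_def v_def m_def meridian_word_def longitude_word_def word_simps)
  have l2: "inv l = v \<otimes> Y \<otimes> m \<otimes> Z \<otimes> m"
    using a b unfolding Y_def Z_def
    by (simp add: l_def v_def m_def meridian_word_def longitude_word_def word_simps)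
  have "m \<otimes> Z \<otimes> m = inv (v \<otimes> Y) \<otimes> (v \<otimes> Y \<otimes> m \<otimes> Z \<otimes> m)"
    by (simp add: word_simps)
  also have "\<dots> = inv (v \<otimes> Y) \<otimes> inv l"
    by (simp add: l2)
  finally have mZm: "m \<otimes> Z \<otimes> m = inv (v \<otimes> Y) \<otimes> inv l" .
  \<comment> \<open>In \<open>l1\<close> a prefixed m exposes the block m Z m, which
    \<open>l2\<close> evaluates without Z. Substituting Y = l v l cancels the rest.\<close>
  have "m \<otimes> inv l = (m \<otimes> Z \<otimes> m) \<otimes> Y \<otimes> v \<otimes> m"
    by (subst l1) (simp add: m_assoc)
  also have "\<dots> = inv l \<otimes> m"
    unfolding mZm Y[symmetric] by (simp add: word_simps)
  finally have "inv (m \<otimes> inv l) = inv (inv l \<otimes> m)" by simp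
  then have "l \<otimes> inv m = inv m \<otimes> l"
    by (simp add: inv_mult_group)
  then show ?thesis
    using a b by (simp add: l_def m_def)
qed

text \<open>The quotient of \<int>^2 by a primitive vector (p, q) is infinite cyclic. A Bezout
  relation u p + v q = 1 supplies the generator c = m^v l^-u.\<close>

lemma peripheral_generator:
  assumes m: "m \<in> carrier G" and l: "l \<in> carrier G" and comm: "m \<otimes> l = l \<otimes> m"
    and cop: "coprime p q" and slope: "m [^] (p::int) \<otimes> l [^] (q::int) = \<one>"
  obtains c where "c \<in> carrier G" "c [^] q = m" "c [^] (- p) = l"
proof -
  obtain u v where uv: "u * p + v * q = 1"
    using cop bezout_int[of p q] by auto
  have comm': "m [^] i \<otimes> l [^] j = l [^] j \<otimes> m [^] i" for i j :: int
  proof -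
    have "x [^] k \<otimes> y = y \<otimes> x [^] k"
      if "x \<in> carrier G" "y \<in> carrier G" "x \<otimes> y = y \<otimes> x" for x y and k :: int
    proof (cases k rule: int_cases2)
      case (nonneg n)
      then show ?thesis using that by (simp add: group_commutes_pow int_pow_int)
    next
      case (nonpos n)
      have "inv (x [^] n) \<otimes> (x [^] n \<otimes> y) \<otimes> inv (x [^] n) = y \<otimes> inv (x [^] n)"
        using that by (simp add: inv_mult_cancel)
      then show ?thesis
        using that nonpos by (simp add: group_commutes_pow int_pow_neg_int word_simps)
    qed
    from this[of m "l [^] j" i] this[of l m j] show ?thesis
      using m l comm by simp
  qed
  have mp: "m [^] p = l [^] (- q)" and lq: "l [^] q = m [^] (- p)"
    using slope m l comm'[of p q] by (simp_all add: int_pow_neg) (metis inv_equality inv_inv int_pow_closed)+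
  define c where "c = m [^] v \<otimes> l [^] (- u)"
  have c: "c [^] i = m [^] (v * i) \<otimes> l [^] (- u * i)" for i :: int
    unfolding c_def using m l comm'[of v "- u"] comm'[of "v * i" "- u * i"]
    by (simp add: int_pow_mult_distrib int_pow_pow)
  have "c [^] q = m [^] (v * q) \<otimes> (l [^] (- q)) [^] u"
    using l by (simp add: c int_pow_pow mult.commute)
  also have "\<dots> = m [^] (v * q + p * u)"
    using m by (simp add: mp[symmetric] int_pow_pow int_pow_mult)
  finally have "c [^] q = m"
    using uv m by (simp add: mult.commute add.commute)
  have "c [^] (- p) = (m [^] (- p)) [^] v \<otimes> l [^] (u * p)"
    using m by (simp add: c int_pow_pow mult.commute)
  also have "\<dots> = l [^] (q * v + u * p)"
    using l by (simp add: lq[symmetric] int_pow_pow int_pow_mult)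
  finally have "c [^] (- p) = l"
    using uv l by (simp add: mult.commute add.commute)
  with \<open>c [^] q = m\<close> m l show thesis
    by (intro that[of c]) (simp_all add: c_def)
qed

end


section \<open>Total cones\<close>

text \<open>
  Total cones correspond to left-invariant total preorders; the elements equivalent to the
  identity are those of \<open>P \<inter> P\<inverse>\<close>.
\<close>

definition total_cone :: "('a, 'm) monoid_scheme \<Rightarrow> 'a set \<Rightarrow> bool" where
  "total_cone G P \<longleftrightarrow> P \<subseteq> carrier G \<and> (\<forall>x\<in>P. \<forall>y\<in>P. x \<otimes> y \<in> P) \<and>
     (\<forall>x\<in>carrier G. x \<in> P \<or> inv x \<in> P)"
  for G (structure)

context group
begin

lemma total_cone_mult: "total_cone G P \<Longrightarrow> x \<in> P \<Longrightarrow> y \<in> P \<Longrightarrow> x \<otimes> y \<in> P"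
  by (simp add: total_cone_def)

lemma total_cone_one: "total_cone G P \<Longrightarrow> \<one> \<in> P"
  by (force simp: total_cone_def)

lemma total_cone_uminus: "total_cone G P \<Longrightarrow> total_cone G {x \<in> carrier G. inv x \<in> P}"
  by (auto simp: total_cone_def inv_mult_group)

lemma total_cone_int_pow:
  assumes P: "total_cone G P" and c: "c \<in> P" "inv c \<in> P"
  shows "c [^] (k::int) \<in> P"
proof -
  have *: "x [^] n \<in> P" if "x \<in> P" for x and n :: nat
    using that by (induction n) (auto intro: total_cone_mult[OF P] total_cone_one[OF P])
  have "c \<in> carrier G"
    using P c by (auto simp: total_cone_def)
  then show ?thesis
    using *[OF c(1)] *[OF c(2)]
    by (cases k rule: int_cases2) (auto simp: int_pow_int int_pow_neg_int nat_pow_inv)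
qed

lemma total_cone_meridian:
  assumes a: "a \<in> carrier G" and b: "b \<in> carrier G" and rel: "v2503_relator G a b = \<one>"
    and P: "total_cone G P"
    and mu: "meridian_word G a b \<in> P" "inv (meridian_word G a b) \<in> P"
  shows "a \<in> P \<and> inv a \<in> P \<and> b \<in> P \<and> inv b \<in> P"
proof -
  have main: "a \<in> P \<and> inv a \<in> P \<and> b \<in> P \<and> inv b \<in> P"
    if P: "total_cone G P" and aP: "a \<in> P"
      and mu: "meridian_word G a b \<in> P" "inv (meridian_word G a b) \<in> P" for P
  proof -
    let ?w = "a \<otimes> meridian_word G a b \<otimes> b \<otimes> a \<otimes> b \<otimes> a \<otimes> a \<otimes> b \<otimes> a \<otimes> b \<otimes> a \<otimes> a"
    note mult = total_cone_mult[OF P]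
    have "b = inv (meridian_word G a b) \<otimes> (inv b \<otimes> inv b \<otimes> a \<otimes> inv b \<otimes> inv b \<otimes> a)"
      using a b by (simp add: meridian_word_def word_simps)
    then have "b \<in> P" if "inv b \<in> P"
      using that aP mu by (metis mult)
    then have bP: "b \<in> P"
      using P b by (auto simp: total_cone_def)
    have wP: "?w \<in> P"
      using aP bP mu by (intro mult)
    have w: "?w \<in> carrier G"
      using a b by simp
    have "a \<otimes> (?w \<otimes> b) = \<one>" "(a \<otimes> ?w) \<otimes> b = \<one>"
      using v2503_relator_eq_meridian[OF a b] rel a b w by (simp_all add: m_assoc)
    then have "inv a = ?w \<otimes> b" "inv b = a \<otimes> ?w"
      using a b w by (metis inv_comm inv_equality m_closed)+
    then have "inv a \<in> P" "inv b \<in> P"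
      using aP bP wP by (simp_all add: mult)
    then show ?thesis
      using aP bP by simp
  qed
  show ?thesis
  proof (cases "a \<in> P")
    case True
    then show ?thesis using main[OF P] mu by blast
  next
    case False
    then have "inv a \<in> P"
      using P a by (auto simp: total_cone_def)
    \<comment> \<open>Hypotheses and conclusion are symmetric under inversion, so reversing the
      preorder reduces to a \<ge> 1.\<close>
    then show ?thesis
      using main[OF total_cone_uminus[OF P]] mu a b by auto
  qed
qed

end


section \<open>Left-ordered groups\<close>

locale left_ordered_group = group G for G (structure) +
  fixes r :: "('a \<times> 'a) set"
  assumes linear: "linear_order_on (carrier G) r"
    and left_mono: "\<lbrakk>f \<in> carrier G; g \<in> carrier G; h \<in> carrier G; (g, h) \<in> r\<rbrakk>
      \<Longrightarrow> (f \<otimes> g, f \<otimes> h) \<in> r"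
begin

lemma le_refl: "x \<in> carrier G \<Longrightarrow> (x, x) \<in> r"
  using linear by (auto simp: order_on_defs refl_on_def)

lemma le_trans: "(x, y) \<in> r \<Longrightarrow> (y, z) \<in> r \<Longrightarrow> (x, z) \<in> r"
  using linear by (auto simp: order_on_defs dest: transD)

lemma le_antisym: "(x, y) \<in> r \<Longrightarrow> (y, x) \<in> r \<Longrightarrow> x = y"
  using linear by (auto simp: order_on_defs dest: antisymD)

lemma le_total: "x \<in> carrier G \<Longrightarrow> y \<in> carrier G \<Longrightarrow> (x, y) \<in> r \<or> (y, x) \<in> r"
  using linear le_refl by (cases "x = y") (auto simp: order_on_defs total_on_def)

text \<open>Turns the upper bounds of \<open>powers_cofinal\<close> into lower bounds.\<close>

lemma left_ordered_group_converse: "left_ordered_group G (r\<inverse>)"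
  by unfold_locales (auto simp: linear intro: left_mono)

lemma left_cancel:
  assumes "f \<in> carrier G" "g \<in> carrier G" "h \<in> carrier G" "(f \<otimes> g, f \<otimes> h) \<in> r"
  shows "(g, h) \<in> r"
  using left_mono[OF _ _ _ assms(4), of "inv f"] assms(1-3) by (simp add: inv_mult_cancel)

lemma square_eq_one:
  assumes x: "x \<in> carrier G" and sq: "x \<otimes> x = \<one>"
  shows "x = \<one>"
  using le_total[OF x one_closed] left_mono[OF x x one_closed] left_mono[OF x one_closed x] x sq
  by (auto intro: le_antisym)

text \<open>
  The cone below belongs to the preorder that compares \<open>g\<close> and \<open>h\<close> by comparing the translates
  \<open>g C\<close> and \<open>h C\<close> of the cut \<open>C\<close> of all elements below some power of \<open>c\<close>.
\<close>

lemma powers_cofinal: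
  assumes c: "c \<in> carrier G"
    and cone: "\<And>P. \<lbrakk>total_cone G P; c \<in> P; inv c \<in> P\<rbrakk> \<Longrightarrow> carrier G \<subseteq> P"
    and g: "g \<in> carrier G"
  shows "\<exists>m::int. (g, c [^] m) \<in> r"
proof -
  \<comment> \<open>Membership of x says C \<subseteq> x C.\<close>
  define P where "P = {x \<in> carrier G. \<forall>n::int. \<exists>m::int. (c [^] n, x \<otimes> c [^] m) \<in> r}"
  have "x \<otimes> y \<in> P" if x: "x \<in> P" and y: "y \<in> P" for x y
  proof -
    have xy: "x \<in> carrier G" "y \<in> carrier G"
      using x y by (auto simp: P_def)
    have "\<exists>m::int. (c [^] n, x \<otimes> y \<otimes> c [^] m) \<in> r" for n :: int
    proof -
      obtain m :: int where m: "(c [^] n, x \<otimes> c [^] m) \<in> r"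
        using x by (auto simp: P_def)
      obtain k :: int where "(c [^] m, y \<otimes> c [^] k) \<in> r"
        using y by (auto simp: P_def)
      then have "(x \<otimes> c [^] m, x \<otimes> (y \<otimes> c [^] k)) \<in> r"
        using xy c by (intro left_mono) auto
      with m show ?thesis
        using xy c by (metis le_trans m_assoc int_pow_closed)
    qed
    with xy show ?thesis by (simp add: P_def)
  qed
  moreover have "x \<in> P \<or> inv x \<in> P" if x: "x \<in> carrier G" for x
  proof (rule disjCI)
    assume "inv x \<notin> P"
    \<comment> \<open>If C is not contained in x^-1 C, some c^n lies above all of x^-1 C, so the
      single element x c^n bounds C.\<close>
    then obtain n :: int where n: "(c [^] n, inv x \<otimes> c [^] m) \<notin> r" for m :: int
      using x by (auto simp: P_def)
    have "(c [^] m, x \<otimes> c [^] n) \<in> r" for m :: int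
    proof -
      have "(inv x \<otimes> c [^] m, c [^] n) \<in> r"
        using n[of m] le_total[of "inv x \<otimes> c [^] m" "c [^] n"] x c by auto
      then have "(x \<otimes> (inv x \<otimes> c [^] m), x \<otimes> c [^] n) \<in> r"
        using x c by (intro left_mono) auto
      then show ?thesis
        using x c by (simp add: inv_mult_cancel)
    qed
    with x show "x \<in> P" by (auto simp: P_def)
  qed
  ultimately have "total_cone G P"
    by (auto simp: total_cone_def P_def)
  moreover have pow: "c [^] k \<in> P" for k :: int
  proof -
    have "(c [^] n, c [^] k \<otimes> c [^] (n - k)) \<in> r" for n :: int
      using c by (simp add: le_refl flip: int_pow_mult)
    with c show ?thesis by (auto simp: P_def)
  qed
  \<comment> \<open>All powers of c fix the cut, so P is everything. Membership of
    \<open>inv g\<close>, read at n = 0, gives 1 \<le> g^-1 c^m, that is g \<le> c^m.\<close>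
  ultimately have "inv g \<in> P"
    using cone[of P] pow[of 1] pow[of "-1"] c g by (auto simp: int_pow_neg)
  then have "\<forall>n::int. \<exists>m::int. (c [^] n, inv g \<otimes> c [^] m) \<in> r"
    by (simp add: P_def)
  then obtain m :: int where "(c [^] (0::int), inv g \<otimes> c [^] m) \<in> r"
    by metis
  then have "(g \<otimes> \<one>, g \<otimes> (inv g \<otimes> c [^] m)) \<in> r"
    using c g by (intro left_mono) auto
  then show ?thesis
    using c g by (auto simp: inv_mult_cancel)
qed

text \<open>Left multiplication by c preserves the order: if it lowered h, every c^n h with n \<ge>
  0 would stay below h. But c^m \<le> h gives c^(n+m) \<le> c^n h, and these powers pass any upper
  bound c^k of h. So all conjugates h^-1 c h are \<ge> 1.\<close>

lemma cofinal_conj_nonneg: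
  assumes c: "c \<in> carrier G" and c1: "(\<one>, c) \<in> r"
    and up: "\<And>g. g \<in> carrier G \<Longrightarrow> \<exists>m::int. (g, c [^] m) \<in> r"
    and down: "\<And>g. g \<in> carrier G \<Longrightarrow> \<exists>m::int. (c [^] m, g) \<in> r"
    and h: "h \<in> carrier G"
  shows "(h, c \<otimes> h) \<in> r"
proof (rule ccontr)
  assume notle: "(h, c \<otimes> h) \<notin> r"
  then have ch: "(c \<otimes> h, h) \<in> r"
    using le_total[of h "c \<otimes> h"] c h by auto
  have nh: "(c [^] n \<otimes> h, h) \<in> r" for n :: nat
  proof (induction n)
    case 0
    then show ?case using h by (simp add: le_refl)
  next
    case (Suc n)
    have "(c [^] n \<otimes> (c \<otimes> h), c [^] n \<otimes> h) \<in> r"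
      using c h ch by (intro left_mono) auto
    with Suc show ?case
      using c h by (auto simp: m_assoc intro: le_trans)
  qed
  have pos: "(\<one>, c [^] n) \<in> r" for n :: nat
  proof (induction n)
    case (Suc n)
    have "(c [^] n \<otimes> \<one>, c [^] n \<otimes> c) \<in> r"
      using c c1 by (intro left_mono) auto
    with Suc show ?case
      using c by (auto intro: le_trans)
  qed (simp add: le_refl)
  have mono: "(c [^] i, c [^] j) \<in> r" if "i \<le> j" for i j :: int
  proof -
    have "(c [^] i \<otimes> \<one>, c [^] i \<otimes> c [^] nat (j - i)) \<in> r"
      using c pos by (intro left_mono) auto
    also have "c [^] i \<otimes> c [^] nat (j - i) = c [^] i \<otimes> c [^] (j - i)"
      using that by (simp flip: int_pow_int)
    finally show ?thesis
      using c by (simp flip: int_pow_mult)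
  qed
  obtain m k :: int where m: "(c [^] m, h) \<in> r" and k: "(h, c [^] k) \<in> r"
    using up down h by blast
  \<comment> \<open>This ensures n + m \<ge> k + 1, also when k + 1 - m is negative and n =
    0.\<close>
  define n where "n = nat (k + 1 - m)"
  have "(c [^] n \<otimes> c [^] m, c [^] n \<otimes> h) \<in> r"
    using c h m by (intro left_mono) auto
  moreover have "c [^] n \<otimes> c [^] m = c [^] (int n + m)"
    using c by (simp add: int_pow_mult int_pow_int)
  ultimately have "(c [^] (int n + m), h) \<in> r"
    using nh[of n] by (auto intro: le_trans)
  moreover have "(c [^] (k + 1), c [^] (int n + m)) \<in> r"
    by (rule mono) (simp add: n_def)
  ultimately have "(c [^] (k + 1), c [^] k) \<in> r"
    using k by (blast intro: le_trans)
  then have "(c [^] k \<otimes> c, c [^] k \<otimes> \<one>) \<in> r"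
    using c by (simp add: int_pow_mult)
  then have "(c, \<one>) \<in> r"
    using c by (rule_tac left_cancel[of "c [^] k"]) auto
  then have "c = \<one>"
    using c1 by (rule le_antisym)
  with notle h show False by (simp add: le_refl)
qed

text \<open>The elements with all conjugates \<ge> 1 form a normal submonoid \<open>A\<close>; here
  \<open>(h, x \<otimes> h) \<in> r\<close> reads h^-1 x h \<ge> 1. It contains c, hence l or l^-1,
  and the relations between l and a^2 then force a^2 and a^-2 into it.\<close>

lemma longitude_conj_nonneg:
  assumes a: "a \<in> carrier G" and b: "b \<in> carrier G" and rel: "v2503_relator G a b = \<one>"
    and c: "c \<in> carrier G" and conj: "\<And>h. h \<in> carrier G \<Longrightarrow> (h, c \<otimes> h) \<in> r"
    and l: "longitude_word G a b = c [^] (k::int)"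
  shows "a = \<one>"
proof -
  define A where "A = {x \<in> carrier G. \<forall>h\<in>carrier G. (h, x \<otimes> h) \<in> r}"
  have A_mult: "x \<otimes> y \<in> A" if "x \<in> A" "y \<in> A" for x y
    using that by (auto simp: A_def m_assoc intro: le_trans)
  have A_conj: "g \<otimes> x \<otimes> inv g \<in> A" if x: "x \<in> A" and g: "g \<in> carrier G" for x g
  proof -
    have xc: "x \<in> carrier G"
      using x by (simp add: A_def)
    have "(h, g \<otimes> x \<otimes> inv g \<otimes> h) \<in> r" if h: "h \<in> carrier G" for h
    proof -
      have "(inv g \<otimes> h, x \<otimes> (inv g \<otimes> h)) \<in> r"
        using x g h by (auto simp: A_def)
      then have "(g \<otimes> (inv g \<otimes> h), g \<otimes> (x \<otimes> (inv g \<otimes> h))) \<in> r"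
        using g h xc by (intro left_mono) auto
      then show ?thesis
        using g h xc by (simp add: word_simps)
    qed
    with g xc show ?thesis by (simp add: A_def)
  qed
  have A_pow: "c [^] n \<in> A" for n :: nat
  proof (induction n)
    case 0
    then show ?case by (simp add: A_def le_refl)
  next
    case (Suc n)
    then show ?case using A_mult[OF Suc, of c] c conj by (simp add: A_def)
  qed
  define l where "l = longitude_word G a b"
  define g where "g = a \<otimes> a \<otimes> inv b \<otimes> inv b \<otimes> a \<otimes> inv b"
  define h where "h = a \<otimes> a \<otimes> inv b"
  have carr: "l \<in> carrier G" "g \<in> carrier G" "h \<in> carrier G"
    using a b by (simp_all add: l_def g_def h_def)
  define w where "w = (h \<otimes> l \<otimes> inv h) \<otimes> (g \<otimes> l \<otimes> inv g)"
  have w: "w \<in> carrier G"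
    using carr by (simp add: w_def)
  have "inv w \<otimes> (a \<otimes> a) = \<one>"
    using v2503_relator_eq_longitude[OF a b] rel by (simp add: w_def l_def g_def h_def)
  then have aa: "a \<otimes> a = w"
    using a w by (simp add: inv_solve_left')
  then have aa': "inv a \<otimes> inv a = inv w"
    using a by (metis inv_mult_group)
  have iw: "inv w = (g \<otimes> inv l \<otimes> inv g) \<otimes> (h \<otimes> inv l \<otimes> inv h)"
    using carr by (simp add: w_def word_simps)
  have l_eq: "l = inv w \<otimes> (inv b \<otimes> inv w \<otimes> inv (inv b))"
    using a b by (simp add: l_def longitude_word_def aa'[symmetric] word_simps)
  have il_eq: "inv l = (inv b \<otimes> w \<otimes> inv (inv b)) \<otimes> w"
    using a b by (simp add: l_def longitude_word_def aa[symmetric] word_simps)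
  \<comment> \<open>The next four implications form a cycle, from l to w = a^2, to l^-1, to w^-1 and
    back to l. Entering it anywhere puts all four elements in \<open>A\<close>.\<close>
  have w_A: "w \<in> A" if "l \<in> A"
    unfolding w_def by (rule A_mult[OF A_conj[OF that carr(3)] A_conj[OF that carr(2)]])
  have iw_A: "inv w \<in> A" if "inv l \<in> A"
    unfolding iw by (rule A_mult[OF A_conj[OF that carr(2)] A_conj[OF that carr(3)]])
  have l_A: "l \<in> A" if "inv w \<in> A"
    by (subst l_eq) (rule A_mult[OF that A_conj[OF that inv_closed[OF b]]])
  have il_A: "inv l \<in> A" if "w \<in> A"
    by (subst il_eq) (rule A_mult[OF A_conj[OF that inv_closed[OF b]] that])
  have "l \<in> A \<or> inv l \<in> A"
  proof (cases k rule: int_cases2)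
    case (nonneg n)
    then show ?thesis using A_pow[of n] l by (simp add: l_def int_pow_int)
  next
    case (nonpos n)
    then show ?thesis using A_pow[of n] l c by (simp add: l_def int_pow_neg_int)
  qed
  then have wA: "w \<in> A" "inv w \<in> A"
    using w_A iw_A l_A il_A by blast+
  have A_le: "(h, x \<otimes> h) \<in> r" if "x \<in> A" "h \<in> carrier G" for x h
    using that by (simp add: A_def)
  have "(w, \<one>) \<in> r" "(\<one>, w) \<in> r"
    using A_le[OF wA(1) one_closed] A_le[OF wA(2) w] w by simp_all
  then have "w = \<one>"
    by (rule le_antisym)
  with aa have "a \<otimes> a = \<one>" by simp
  then show ?thesis by (rule square_eq_one[OF a])
qed

text \<open>The hypothesis \<open>gen\<close> is the consequence for cones of a and b generating.
  With \<open>total_cone_meridian\<close> it makes every cone containing c and c^-1 the whole group,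
  so c is cofinal. The conclusion is absurd in a filling group, where a is nontrivial.\<close>

lemma filling_generator_eq_one:
  assumes a: "a \<in> carrier G" and b: "b \<in> carrier G" and rel: "v2503_relator G a b = \<one>"
    and gen: "\<And>P. \<lbrakk>total_cone G P; a \<in> P; inv a \<in> P; b \<in> P; inv b \<in> P\<rbrakk> \<Longrightarrow> carrier G \<subseteq> P"
    and cop: "coprime p q"
    and slope: "meridian_word G a b [^] (p::int) \<otimes> longitude_word G a b [^] (q::int) = \<one>"
  shows "a = \<one>"
proof -
  obtain c where c: "c \<in> carrier G" "c [^] q = meridian_word G a b"
      "c [^] (- p) = longitude_word G a b"
    using peripheral_generator[OF _ _ meridian_longitude_commute[OF a b rel] cop slope] a b by auto
  \<comment> \<open>The exponents j and k are arbitrary so that c \<le> 1 can be handled by passing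
    to c^-1 and negating them.\<close>
  have main: "a = \<one>"
    if c: "c \<in> carrier G" "c [^] j = meridian_word G a b" "c [^] k = longitude_word G a b"
      and c1: "(\<one>, c) \<in> r" for c and j k :: int
  proof -
    have cone: "carrier G \<subseteq> P" if P: "total_cone G P" and cP: "c \<in> P" "inv c \<in> P" for P
    proof -
      have "c [^] i \<in> P" for i :: int
        using P cP by (rule total_cone_int_pow)
      from this[of j] this[of "- j"] have "meridian_word G a b \<in> P" "inv (meridian_word G a b) \<in> P"
        using c by (simp_all add: int_pow_neg)
      from total_cone_meridian[OF a b rel P this] show ?thesis
        by (intro gen P) auto
    qed
    interpret converse: left_ordered_group G "r\<inverse>"
      by (rule left_ordered_group_converse)
    have "(h, c \<otimes> h) \<in> r" if "h \<in> carrier G" for h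
      using cofinal_conj_nonneg[OF c(1) c1 _ _ that] powers_cofinal[OF c(1) cone]
        converse.powers_cofinal[OF c(1) cone] by auto
    then show ?thesis
      using longitude_conj_nonneg[OF a b rel c(1)] c(3) by metis
  qed
  show ?thesis
  proof (cases "(\<one>, c) \<in> r")
    case True
    then show ?thesis using main c by blast
  next
    case False
    then have "(inv c \<otimes> c, inv c \<otimes> \<one>) \<in> r"
      using c le_total[of \<one> c] by (intro left_mono) auto
    then have "(\<one>, inv c) \<in> r"
      using c by simp
    moreover have "inv c [^] (- i) = c [^] i" for i :: int
      using c by (simp add: int_pow_neg int_pow_inv)
    ultimately show ?thesis
      using main[of "inv c" "- q" p] c by (metis inv_closed minus_minus)
  qed
qed

end


section \<open>The filling groups\<close>

lemma (in group) normal_closure_incl: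
  assumes "S \<subseteq> carrier G" "s \<in> S"
  shows "s \<in> normal_closure G S"
proof -
  have "\<one> \<otimes> s \<otimes> inv \<one> \<in> normal_closure G S"
    unfolding normal_closure_def by (rule generate.incl) (use assms in blast)
  then show ?thesis
    using assms by auto
qed

lemma (in group_hom) normal_closure_subset_kernel:
  assumes "S \<subseteq> carrier G" and S: "\<And>s. s \<in> S \<Longrightarrow> h s = \<one>\<^bsub>H\<^esub>"
  shows "normal_closure G S \<subseteq> kernel G H h"
  unfolding normal_closure_def
proof (rule G.generate_subgroup_incl)
  show "{g \<otimes> s \<otimes> inv g | g s. g \<in> carrier G \<and> s \<in> S} \<subseteq> kernel G H h"
    using assms by (auto simp: kernel_def subset_iff)
  show "subgroup (kernel G H h) G"
    by (rule subgroup_kernel)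
qed

text \<open>Applied twice, this universal property carries the parity of a through the relator and
  then through the slope.\<close>

lemma (in group_hom) factor_normal_closure:
  assumes SG: "S \<subseteq> carrier G" and S: "\<And>s. s \<in> S \<Longrightarrow> h s = \<one>\<^bsub>H\<^esub>"
  obtains k where "k \<in> hom (G Mod normal_closure G S) H"
    "\<And>x. x \<in> carrier G \<Longrightarrow> k (normal_closure G S #> x) = h x"
proof (rule FactGroup_universal)
  show "h \<in> hom G H" by (rule homh)
  show N: "normal_closure G S \<lhd> G" by (rule G.normal_closure_normal[OF SG])
  fix x y
  assume x: "x \<in> carrier G" and y: "y \<in> carrier G"
    and eq: "normal_closure G S #> x = normal_closure G S #> y"
  have "x \<in> normal_closure G S #> y"
    using G.rcos_self[OF x normal_imp_subgroup[OF N]] eq by simp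
  then obtain n where n: "n \<in> normal_closure G S" "x = n \<otimes> y"
    by (auto simp: r_coset_def)
  then have "n \<in> carrier G" "h n = \<one>\<^bsub>H\<^esub>"
    using normal_closure_subset_kernel[OF SG S] by (auto simp: kernel_def)
  with n y show "h x = h y" by simp
qed (use that in blast)

lemma (in group_hom) hom_words:
  assumes "a \<in> carrier G" "b \<in> carrier G"
  shows "h (v2503_relator G a b) = v2503_relator H (h a) (h b)"
    "h (meridian_word G a b) = meridian_word H (h a) (h b)"
    "h (longitude_word G a b) = longitude_word H (h a) (h b)"
  using assms
  by (simp_all add: v2503_relator_def meridian_word_def longitude_word_def hom_int_pow)

text \<open>A reduced word is the product of its letters. Inverse generators are assumed separately
  because \<open>P\<close> will be a cone, closed under products only.\<close>

lemma free_group_induct: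
  assumes w: "w \<in> carrier (free_group :: 'a letter list monoid)"
    and h: "group_hom free_group H h"
    and mult: "\<And>x y. x \<in> P \<Longrightarrow> y \<in> P \<Longrightarrow> x \<otimes>\<^bsub>H\<^esub> y \<in> P" and one: "\<one>\<^bsub>H\<^esub> \<in> P"
    and gen: "\<And>x. h (free_gen x) \<in> P" "\<And>x. inv\<^bsub>H\<^esub> h (free_gen x) \<in> P"
  shows "h w \<in> P"
proof -
  interpret group_hom free_group H h by (rule h)
  have letter: "h [k] \<in> P" for k :: "'a letter"
  proof -
    obtain x s where k: "k = (x, s)" by (cases k)
    have "inv\<^bsub>free_group\<^esub> free_gen x = [(x, False)]"
      by (rule G.inv_equality)
        (auto simp: free_group_def free_gen_def reduced_def inv_letter_def)
    then have "h [(x, False)] = inv\<^bsub>H\<^esub> h (free_gen x)"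
      using free_gen_carrier hom_inv by metis
    then show ?thesis
      using gen[of x] k by (cases s) (auto simp: free_gen_def)
  qed
  have "reduced w"
    using w by (simp add: free_group_def)
  then show ?thesis
  proof (induction w)
    case Nil
    then show ?case
      using one hom_one by (simp add: free_group_def)
  next
    case (Cons k w)
    have "foldr red_cons (k # w) [] = k # w"
      using Cons.prems by (rule foldr_red_cons_Nil)
    moreover have "foldr red_cons w [] = w"
      using reduced_ConsD[OF Cons.prems] by (rule foldr_red_cons_Nil)
    ultimately have "k # w = [k] \<otimes>\<^bsub>free_group\<^esub> w"
      by (simp add: free_group_def)
    moreover have "[k] \<in> carrier free_group" "w \<in> carrier free_group"
      using reduced_ConsD[OF Cons.prems] by (simp_all add: free_group_def reduced_def)
    ultimately have "h (k # w) = h [k] \<otimes>\<^bsub>H\<^esub> h w"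
      by simp
    then show ?case
      using mult[OF letter Cons.IH[OF reduced_ConsD[OF Cons.prems]]] by simp
  qed
qed

text \<open>The homomorphism to \<int>/2 with a \<mapsto> 1, b \<mapsto> 0; signs of letters are
  ignored since -1 = 1 mod 2.\<close>

definition a_parity :: "v2503_gen letter list \<Rightarrow> int" where
  "a_parity w = int (length (filter (\<lambda>k. fst k = Gen_a) w)) mod 2"

lemma a_parity_red_cons:
  "a_parity (red_cons k w) = (a_parity [k] + a_parity w) mod 2"
proof (cases w)
  case (Cons l w')
  \<comment> \<open>A cancelling pair has a common generator, so it contributes 0 or 2 to the
    count.\<close>
  have "(1 + (1 + n)) mod 2 = n mod 2" for n :: int
    by presburger
  with Cons show ?thesis
    by (auto simp: a_parity_def inv_letter_def mod_simps)
qed (simp add: a_parity_def)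

lemma a_parity_mult:
  "a_parity (foldr red_cons u v) = (a_parity u + a_parity v) mod 2"
proof (induction u)
  case Nil
  then show ?case by (simp add: a_parity_def)
next
  case (Cons k u)
  have "a_parity (k # u) = (a_parity [k] + a_parity u) mod 2"
    by (simp add: a_parity_def mod_simps)
  with Cons show ?case
    by (simp add: a_parity_red_cons mod_simps add.assoc)
qed

lemma group_hom_a_parity: "group_hom free_group (integer_mod_group 2) a_parity"
proof -
  have "a_parity \<in> hom free_group (integer_mod_group 2)"
    by (auto simp: hom_def carrier_integer_mod_group free_group_def a_parity_mult)
       (simp_all add: a_parity_def)
  then show ?thesis
    by (simp add: group_hom_def group_hom_axioms_def group_free_group)
qed

section \<open>Generators and relations of the filling groups\<close>

lemma group_hom_coset:
  assumes "N \<lhd> G"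
  shows "group_hom G (G Mod N) (\<lambda>x. N #>\<^bsub>G\<^esub> x)"
  using assms normal.r_coset_hom_Mod normal.factorgroup_is_group normal_imp_subgroup
  by (fastforce simp: group_hom_def group_hom_axioms_def normal_def)

definition slope_element :: "int \<Rightarrow> int \<Rightarrow> v2503_gen letter list set" where
  "slope_element p q =
     v2503_meridian [^]\<^bsub>v2503_group\<^esub> p \<otimes>\<^bsub>v2503_group\<^esub> v2503_longitude [^]\<^bsub>v2503_group\<^esub> q"

definition filling_elem :: "int \<Rightarrow> int \<Rightarrow> v2503_gen \<Rightarrow> v2503_gen letter list set set" where
  "filling_elem p q x =
     normal_closure v2503_group {slope_element p q} #>\<^bsub>v2503_group\<^esub> v2503_elem x"

lemma filling_group_eq:
  "v2503_filling_group p q = v2503_group Mod normal_closure v2503_group {slope_element p q}"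
  by (simp add: v2503_filling_group_def slope_element_def)

lemma slope_element_carrier: "slope_element p q \<in> carrier v2503_group"
proof -
  interpret group v2503_group by (rule group_v2503_group)
  show ?thesis by (simp add: slope_element_def v2503_peripheral_carrier)
qed

lemma group_hom_v2503: "group_hom free_group v2503_group
    (\<lambda>w. normal_closure free_group v2503_relators #>\<^bsub>free_group\<^esub> w)"
  unfolding v2503_group_def by (rule group_hom_coset[OF normal_v2503_relators])

lemma normal_slope: "normal_closure v2503_group {slope_element p q} \<lhd> v2503_group"
  by (rule group.normal_closure_normal[OF group_v2503_group]) (simp add: slope_element_carrier)

lemma group_hom_filling: "group_hom v2503_group (v2503_filling_group p q)
    (\<lambda>y. normal_closure v2503_group {slope_element p q} #>\<^bsub>v2503_group\<^esub> y)"
  unfolding filling_group_eq by (rule group_hom_coset[OF normal_slope])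

lemma filling_elem_carrier: "filling_elem p q x \<in> carrier (v2503_filling_group p q)"
  unfolding filling_elem_def
  by (rule group_hom.hom_closed[OF group_hom_filling v2503_elem_carrier])

lemma v2503_relator_eq_one:
  "v2503_relator v2503_group (v2503_elem Gen_a) (v2503_elem Gen_b) = \<one>\<^bsub>v2503_group\<^esub>"
proof -
  interpret group_hom free_group v2503_group
      "\<lambda>w. normal_closure free_group v2503_relators #>\<^bsub>free_group\<^esub> w"
    by (rule group_hom_v2503)
  let ?R = "v2503_relator free_group (free_gen Gen_a) (free_gen Gen_b)"
  have "?R \<in> normal_closure free_group v2503_relators"
    by (rule G.normal_closure_incl[OF v2503_relators_carrier]) (simp add: v2503_relators_def)
  then have "normal_closure free_group v2503_relators #>\<^bsub>free_group\<^esub> ?R =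
      normal_closure free_group v2503_relators"
    by (rule subgroup.rcos_const[OF normal_imp_subgroup[OF normal_v2503_relators] G.is_group])
  then show ?thesis
    using hom_words(1)[of "free_gen Gen_a" "free_gen Gen_b"]
    by (simp add: free_gen_carrier v2503_group_def v2503_elem_def)
qed

lemma filling_relator_eq_one:
  "v2503_relator (v2503_filling_group p q) (filling_elem p q Gen_a) (filling_elem p q Gen_b) =
     \<one>\<^bsub>v2503_filling_group p q\<^esub>"
  using group_hom.hom_words(1)[OF group_hom_filling v2503_elem_carrier v2503_elem_carrier]
    group_hom.hom_one[OF group_hom_filling]
  unfolding filling_elem_def by (metis v2503_relator_eq_one)

lemma filling_slope_eq_one:
  fixes p q :: int
  defines "G \<equiv> v2503_filling_group p q"
    and "a \<equiv> filling_elem p q Gen_a" and "b \<equiv> filling_elem p q Gen_b"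
  shows "meridian_word G a b [^]\<^bsub>G\<^esub> p \<otimes>\<^bsub>G\<^esub> longitude_word G a b [^]\<^bsub>G\<^esub> q = \<one>\<^bsub>G\<^esub>"
proof -
  define N where "N = normal_closure v2503_group {slope_element p q}"
  interpret group_hom v2503_group G "\<lambda>y. N #>\<^bsub>v2503_group\<^esub> y"
    unfolding G_def N_def by (rule group_hom_filling)
  have "slope_element p q \<in> N"
    unfolding N_def by (rule G.normal_closure_incl) (simp_all add: slope_element_carrier)
  then have "N #>\<^bsub>v2503_group\<^esub> slope_element p q = N"
    unfolding N_def by (rule subgroup.rcos_const[OF normal_imp_subgroup[OF normal_slope] G.is_group])
  also have "N = \<one>\<^bsub>G\<^esub>"
    by (simp add: G_def N_def filling_group_eq)
  finally have "N #>\<^bsub>v2503_group\<^esub> slope_element p q = \<one>\<^bsub>G\<^esub>" .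
  moreover have "a = N #>\<^bsub>v2503_group\<^esub> v2503_elem Gen_a" "b = N #>\<^bsub>v2503_group\<^esub> v2503_elem Gen_b"
    by (simp_all add: a_def b_def filling_elem_def N_def)
  ultimately show ?thesis
    using hom_words(2,3)[OF v2503_elem_carrier[of Gen_a] v2503_elem_carrier[of Gen_b]]
    by (simp add: slope_element_def hom_int_pow v2503_peripheral_carrier
        flip: v2503_meridian_def v2503_longitude_def)
qed

text \<open>Both quotient maps are onto, so every element is the image of a word in the free group.
  This supplies \<open>gen\<close> for cones.\<close>

lemma filling_group_generated:
  fixes p q :: int
  defines "G \<equiv> v2503_filling_group p q"
  assumes mult: "\<And>x y. x \<in> P \<Longrightarrow> y \<in> P \<Longrightarrow> x \<otimes>\<^bsub>G\<^esub> y \<in> P" and one: "\<one>\<^bsub>G\<^esub> \<in> P"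
    and gen: "\<And>x. filling_elem p q x \<in> P" "\<And>x. inv\<^bsub>G\<^esub> filling_elem p q x \<in> P"
  shows "carrier G \<subseteq> P"
proof
  let ?f = "\<lambda>w. normal_closure free_group v2503_relators #>\<^bsub>free_group\<^esub> w"
  let ?g = "\<lambda>y. normal_closure v2503_group {slope_element p q} #>\<^bsub>v2503_group\<^esub> y"
  fix x
  assume "x \<in> carrier G"
  then obtain w where w: "w \<in> carrier free_group" "x = ?g (?f w)"
    by (auto simp: G_def filling_group_eq carrier_FactGroup v2503_group_def)
  have "group_hom free_group G (?g \<circ> ?f)"
    using group_hom_v2503 group_hom_filling[of p q] unfolding G_def group_hom_def group_hom_axioms_def
    by (blast intro: hom_compose)
  from free_group_induct[OF w(1) this mult one] gen show "x \<in> P"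
    by (simp add: w filling_elem_def v2503_elem_def)
qed

text \<open>The exponent sums of a in the relator, the meridian and the longitude are 10, 2 and -4.
  All are even, so the parity survives both quotients for every slope, and it is 1 on a.\<close>

lemma filling_elem_a_neq_one: "filling_elem p q Gen_a \<noteq> \<one>\<^bsub>v2503_filling_group p q\<^esub>"
proof
  assume one: "filling_elem p q Gen_a = \<one>\<^bsub>v2503_filling_group p q\<^esub>"
  let ?Z = "integer_mod_group 2"
  interpret par: group_hom free_group ?Z a_parity by (rule group_hom_a_parity)
  have gens: "a_parity (free_gen Gen_a) = 1" "a_parity (free_gen Gen_b) = 0"
    by (simp_all add: a_parity_def free_gen_def)
  have words: "v2503_relator ?Z 1 0 = 0" "meridian_word ?Z 1 0 = 0" "longitude_word ?Z 1 0 = 0"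
    by (simp_all add: v2503_relator_def meridian_word_def longitude_word_def int_pow_integer_mod_group)
  obtain k where k: "k \<in> hom v2503_group ?Z"
      "\<And>w. w \<in> carrier free_group \<Longrightarrow>
        k (normal_closure free_group v2503_relators #>\<^bsub>free_group\<^esub> w) = a_parity w"
  proof (rule par.factor_normal_closure[OF v2503_relators_carrier])
    fix s
    assume "s \<in> v2503_relators"
    then show "a_parity s = \<one>\<^bsub>?Z\<^esub>"
      by (simp add: v2503_relators_def par.hom_words free_gen_carrier gens words)
  qed (rule that[unfolded v2503_group_def])
  interpret k: group_hom v2503_group ?Z k
    using k(1) by (simp add: group_hom_def group_hom_axioms_def group_v2503_group)
  have k_gens: "k (v2503_elem Gen_a) = 1" "k (v2503_elem Gen_b) = 0"
    using gens by (simp_all add: v2503_elem_def k(2) free_gen_carrier)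
  have "k v2503_meridian = 0" "k v2503_longitude = 0"
    by (simp_all add: v2503_meridian_def v2503_longitude_def k.hom_words v2503_elem_carrier k_gens
        words)
  then have k_slope: "k (slope_element p q) = \<one>\<^bsub>?Z\<^esub>"
    by (simp add: slope_element_def v2503_peripheral_carrier k.hom_int_pow int_pow_integer_mod_group)
  have slope: "{slope_element p q} \<subseteq> carrier v2503_group"
    by (simp add: slope_element_carrier)
  obtain f where f: "f \<in> hom (v2503_filling_group p q) ?Z"
      "\<And>y. y \<in> carrier v2503_group \<Longrightarrow>
        f (normal_closure v2503_group {slope_element p q} #>\<^bsub>v2503_group\<^esub> y) = k y"
  proof (rule k.factor_normal_closure[OF slope])
    fix s
    assume "s \<in> {slope_element p q}"
    then show "k s = \<one>\<^bsub>?Z\<^esub>"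
      using k_slope by simp
  qed (rule that[unfolded filling_group_eq])
  have "f (filling_elem p q Gen_a) = 1"
    by (simp add: filling_elem_def f(2) v2503_elem_carrier k_gens)
  moreover have "f \<one>\<^bsub>v2503_filling_group p q\<^esub> = 0"
    using hom_one[OF f(1) group_v2503_filling_group] by simp
  ultimately show False
    using one by simp
qed

theorem theorem1p5:
  fixes p q :: int
  assumes "coprime p q"
  shows "\<not> left_orderable (v2503_filling_group p q)"
proof
  let ?G = "v2503_filling_group p q"
  assume "left_orderable ?G"
  then obtain r where "left_ordered_group ?G r"
    using group_v2503_filling_group[of p q]
    by (auto simp: left_orderable_def left_ordered_group_def left_ordered_group_axioms_def)
  then interpret left_ordered_group ?G r .
  have "filling_elem p q Gen_a = \<one>\<^bsub>?G\<^esub>"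
  proof (rule filling_generator_eq_one)
    fix P
    assume P: "total_cone ?G P"
      and gens: "filling_elem p q Gen_a \<in> P" "inv\<^bsub>?G\<^esub> filling_elem p q Gen_a \<in> P"
        "filling_elem p q Gen_b \<in> P" "inv\<^bsub>?G\<^esub> filling_elem p q Gen_b \<in> P"
    show "carrier ?G \<subseteq> P"
    proof (rule filling_group_generated)
      show "filling_elem p q x \<in> P" "inv\<^bsub>?G\<^esub> filling_elem p q x \<in> P" for x
        using gens by (cases x; simp)+
    qed (use total_cone_mult[OF P] total_cone_one[OF P] in auto)
  qed (use assms filling_elem_carrier filling_relator_eq_one filling_slope_eq_one in auto)
  with filling_elem_a_neq_one show False by blast
qed

end
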